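(* Let $n\ge2$ and let $\widetilde W$ be the extended affine Weyl group of type $\mathsf C_n^{(1)}$. If $i=n$, then $$\omega_n=\pi_n\,s_n[n-1,n]\cdots[1,n].$$ If $1\le i<n$, then $$\omega_i=(s_0[1,n])^i\,[n-i,n-1]\cdots[2,i+1][1,i].$$ Moreover, the formulae above yield reduced expressions.
   Context: Let $\mathfrak g$ be the simple Lie algebra of type $\mathsf C_n$ (Bourbaki labelling: $\alpha_j=e_j-e_{j+1}$ for $j\le n-1$, $\alpha_n=2e_n$), $\theta=2e_1=\alpha_n+2\sum_{i=1}^{n-1}\alpha_i$ its highest root, $\delta$ the basic imaginary root and $\alpha_0=\delta-\theta$. The affine Weyl group $W=\langle s_0,\dots,s_n\rangle$ is generated by the simple reflections of the untwisted affine root system, acting on $\bigoplus_{i=0}^n\mathbb Z\alpha_i$. The extended affine Weyl group $\widetilde W$ is the semidirect product of $W_0=\langle s_1,\dots,s_n\rangle$ with the lattice of translations with basis $\omega_1,\dots,\omega_n$, where, as an element of $\widetilde W$, $\omega_i$ acts on $\mathbb R^n$ as translation by $e_1+\cdots+e_i$ for $i<n$ and by $\frac12(e_1+\cdots+e_n)$ for $i=n$ (the fundamental weights of the dual type $\mathsf B_n$), and $s_0$ acts as $t_{\theta^\vee}r_\theta$ (reflection $r_\theta$ in $\theta$ followed by translation by $\theta^\vee=e_1$). Equivalently, on roots, $\omega_i(\alpha_j)=\alpha_j-\delta_{ij}\delta$ ($1\le j\le n$), $\omega_i(\delta)=\delta$. One has $\widetilde W=\Lambda\ltimes W$ with $\Lambda=\{1,\pi_n\}$,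 where $\pi_n$ is the diagram automorphism interchanging $\alpha_k$ and $\alpha_{n-k}$ ($0\le k\le n$). The length satisfies $\ell(\lambda w)=\ell(w)$ for $\lambda\in\Lambda$, $w\in W$; an expression $\lambda s_{i_1}\cdots s_{i_r}$ is reduced if $r=\ell(\lambda s_{i_1}\cdots s_{i_r})$. Notation: $[k,l]=s_ks_{k+1}\cdots s_l$ for $1\le k\le l$; $s_n[n-1,n]\cdots[1,n]=[n,n][n-1,n][n-2,n]\cdots[1,n]$; $[n-i,n-1]\cdots[2,i+1][1,i]$ is the product of $[j,j+i-1]$ for $j=n-i,n-i-1,\dots,1$ in this order. *)

theory Defs
  imports Complex_Main
begin

(* R^n is modelled on functions nat => real, the coordinates being those with index in {1..n}.
   All maps below leave the remaining coordinates unchanged, so equality of maps on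
   nat => real is the same as equality of the induced affine maps of R^n. *)
type_synonym rvec = "nat \<Rightarrow> real"

definition unit_vec :: "nat \<Rightarrow> rvec" where
  "unit_vec j = (\<lambda>k. if k = j then 1 else 0)"

definition ip :: "nat \<Rightarrow> rvec \<Rightarrow> rvec \<Rightarrow> real" where
  "ip n x y = (\<Sum>k=1..n. x k * y k)"

definition reflection :: "nat \<Rightarrow> rvec \<Rightarrow> rvec \<Rightarrow> rvec" where
  "reflection n a x = (\<lambda>k. x k - 2 * ip n x a / ip n a a * a k)"

definition transl :: "rvec \<Rightarrow> rvec \<Rightarrow> rvec" where
  "transl v x = (\<lambda>k. x k + v k)"

(* The roots alpha_1, ..., alpha_n of C_n; only 1 <= j <= n is meaningful. *)
definition simple_root :: "nat \<Rightarrow> nat \<Rightarrow> rvec" where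
  "simple_root n j =
     (if j < n then (\<lambda>k. unit_vec j k - unit_vec (j + 1) k) else (\<lambda>k. 2 * unit_vec n k))"

definition highest_root :: rvec where
  "highest_root = (\<lambda>k. 2 * unit_vec 1 k)"

definition coroot :: "nat \<Rightarrow> rvec \<Rightarrow> rvec" where
  "coroot n a = (\<lambda>k. 2 * a k / ip n a a)"

(* The simple reflections s_0, ..., s_n, as affine maps. *)
definition sref :: "nat \<Rightarrow> nat \<Rightarrow> rvec \<Rightarrow> rvec" where
  "sref n j =
     (if j = 0 then transl (coroot n highest_root) \<circ> reflection n highest_root
      else reflection n (simple_root n j))"

(* The product s_{i_1} ... s_{i_r} of a word [i_1, ..., i_r]. *)
definition word_prod :: "nat \<Rightarrow> nat list \<Rightarrow> rvec \<Rightarrow> rvec" where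
  "word_prod n is = foldr (\<lambda>i g. sref n i \<circ> g) is id"

definition fund_coweight :: "nat \<Rightarrow> nat \<Rightarrow> rvec" where
  "fund_coweight n i =
     (if i < n then (\<lambda>k. \<Sum>j=1..i. unit_vec j k) else (\<lambda>k. 1 / 2 * (\<Sum>j=1..n. unit_vec j k)))"

definition omega :: "nat \<Rightarrow> nat \<Rightarrow> rvec \<Rightarrow> rvec" where
  "omega n i = transl (fund_coweight n i)"

(* The simple reflections are involutions, so the groups they generate consist of the
   products of words. *)
definition fin_weyl :: "nat \<Rightarrow> (rvec \<Rightarrow> rvec) set" where
  "fin_weyl n = {word_prod n is |is. set is \<subseteq> {1..n}}"

definition aff_weyl :: "nat \<Rightarrow> (rvec \<Rightarrow> rvec) set" where
  "aff_weyl n = {word_prod n is |is. set is \<subseteq> {0..n}}"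

definition transl_lattice :: "nat \<Rightarrow> (rvec \<Rightarrow> rvec) set" where
  "transl_lattice n =
     {transl (\<lambda>k. \<Sum>i=1..n. of_int (m i) * fund_coweight n i k) |m :: nat \<Rightarrow> int. True}"

definition ext_weyl :: "nat \<Rightarrow> (rvec \<Rightarrow> rvec) set" where
  "ext_weyl n = {t \<circ> w |t w. t \<in> transl_lattice n \<and> w \<in> fin_weyl n}"

(* The affine function x |-> (alpha_j, x) on R^n for j >= 1, and delta - theta for j = 0, where
   delta is the constant function 1.  A group element g acts on such functions by
   f |-> f o g^{-1}. *)
definition aff_root :: "nat \<Rightarrow> nat \<Rightarrow> rvec \<Rightarrow> real" where
  "aff_root n j x =
     (if j = 0 then 1 - ip n highest_root x else ip n (simple_root n j) x)"

(* The affine map of R^n inducing the diagram automorphism alpha_k <-> alpha_{n-k};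
   it is characterised by this property in aff_root_diag_aut and diag_aut_unique. *)
definition diag_aut :: "nat \<Rightarrow> rvec \<Rightarrow> rvec" where
  "diag_aut n x = (\<lambda>k. if k \<in> {1..n} then 1 / 2 - x (n + 1 - k) else x k)"

definition diag_group :: "nat \<Rightarrow> (rvec \<Rightarrow> rvec) set" where
  "diag_group n = {id, diag_aut n}"

definition cox_length :: "nat \<Rightarrow> (rvec \<Rightarrow> rvec) \<Rightarrow> nat" where
  "cox_length n w = (LEAST r. \<exists>is. set is \<subseteq> {0..n} \<and> length is = r \<and> word_prod n is = w)"

(* The length of lambda w is that of w; see diag_group_decomp_unique and
   ext_length_diag_aff for well-definedness. *)
definition ext_length :: "nat \<Rightarrow> (rvec \<Rightarrow> rvec) \<Rightarrow> nat" where
  "ext_length n x =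
     cox_length n (THE w. w \<in> aff_weyl n \<and> (\<exists>l\<in>diag_group n. x = l \<circ> w))"

(* The expression lambda s_{i_1} ... s_{i_r} is reduced. *)
definition reduced_expr :: "nat \<Rightarrow> (rvec \<Rightarrow> rvec) \<Rightarrow> nat list \<Rightarrow> bool" where
  "reduced_expr n l is \<longleftrightarrow>
     l \<in> diag_group n \<and> set is \<subseteq> {0..n} \<and> l \<circ> word_prod n is \<in> ext_weyl n \<and>
     length is = ext_length n (l \<circ> word_prod n is)"

definition seg :: "nat \<Rightarrow> nat \<Rightarrow> nat list" where
  "seg k l = [k..<Suc l]"

(* s_n [n-1,n] ... [1,n] *)
definition stair_word :: "nat \<Rightarrow> nat list" where
  "stair_word n = concat (map (\<lambda>j. seg j n) (rev [1..<Suc n]))"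

(* [n-i,n-1] ... [2,i+1] [1,i] *)
definition block_word :: "nat \<Rightarrow> nat \<Rightarrow> nat list" where
  "block_word n i = concat (map (\<lambda>j. seg j (j + i - 1)) (rev [1..<Suc (n - i)]))"

(* (s_0 [1,n])^i *)
definition power_word :: "nat \<Rightarrow> nat \<Rightarrow> nat list" where
  "power_word n i = concat (replicate i (0 # seg 1 n))"

lemma ip_unit_vec: "ip n (unit_vec j) x = (if j \<in> {1..n} then x j else 0)"
proof -
  have "ip n (unit_vec j) x = (\<Sum>k=1..n. if k = j then x k else 0)"
    unfolding ip_def unit_vec_def by (rule sum.cong) auto
  then show ?thesis by simp
qed

lemma aff_root_eq:
  assumes "n \<ge> 1" "j \<le> n"
  shows "aff_root n j x = (if j = 0 then 1 - 2 * x 1 else if j < n then x j - x (j + 1) else 2 * x n)"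
proof -
  have 1: "ip n (\<lambda>k. 2 * unit_vec i k) x = 2 * ip n (unit_vec i) x" for i
    by (simp add: ip_def sum_distrib_left mult.assoc)
  have 2: "ip n (\<lambda>k. unit_vec j k - unit_vec (j + 1) k) x = ip n (unit_vec j) x - ip n (unit_vec (j + 1)) x"
    by (simp add: ip_def sum_subtractf left_diff_distrib)
  show ?thesis
    using assms unfolding aff_root_def simple_root_def highest_root_def
    by (simp add: 1 2[simplified] ip_unit_vec)
qed

lemma fund_coweight_eq:
  assumes "i \<le> n"
  shows "fund_coweight n i k = (if k \<in> {1..i} then if i < n then 1 else 1 / 2 else 0)"
  using assms by (auto simp: fund_coweight_def unit_vec_def)

(* omega_i(alpha_j) = alpha_j - delta_{ij} delta *)
lemma aff_root_omega:
  assumes "n \<ge> 1" "i \<in> {1..n}" "j \<in> {1..n}"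
  shows "aff_root n j (omega n i x) = aff_root n j x + (if i = j then 1 else 0)"
  using assms by (auto simp: aff_root_eq omega_def transl_def fund_coweight_eq)

lemma diag_aut_involution: "diag_aut n (diag_aut n x) = x"
  by (auto simp: diag_aut_def fun_eq_iff)

lemma aff_root_diag_aut:
  assumes "n \<ge> 1" "k \<le> n"
  shows "aff_root n k (diag_aut n x) = aff_root n (n - k) x"
  using assms by (auto simp: aff_root_eq diag_aut_def Suc_diff_le Suc_diff_Suc)

lemma aff_root_separates:
  assumes n: "n \<ge> 1" and eq: "\<And>k. k \<le> n \<Longrightarrow> aff_root n k x = aff_root n k y"
    and k: "k \<in> {1..n}"
  shows "x k = y k"
proof -
  have "x (n - d) = y (n - d)" if "d < n" for d
    using that
  proof (induction d)
    case 0
    then show ?case using eq[of n] n by (simp add: aff_root_eq)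
  next
    case (Suc d)
    then show ?case using eq[of "n - Suc d"] n by (simp add: aff_root_eq Suc_diff_Suc)
  qed
  from this[of "n - k"] k show ?thesis by auto
qed

lemma diag_aut_unique:
  assumes "n \<ge> 1"
    and "\<And>k x. k \<le> n \<Longrightarrow> aff_root n k (g x) = aff_root n (n - k) x"
    and "\<And>k x. k \<notin> {1..n} \<Longrightarrow> g x k = x k"
  shows "g = diag_aut n"
proof (intro ext)
  fix x k
  show "g x k = diag_aut n x k"
  proof (cases "k \<in> {1..n}")
    case True
    show ?thesis
      by (rule aff_root_separates[OF assms(1) _ True]) (simp add: assms(2) aff_root_diag_aut[OF assms(1)])
  next
    case False
    then show ?thesis unfolding assms(3)[OF False] diag_aut_def by (simp only: if_False)
  qed
qed

lemma reflection_simple_root: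
  assumes "1 \<le> j" "j \<le> n"
  shows "reflection n (simple_root n j) x k =
    (if j < n then (if k = j then x (j + 1) else if k = j + 1 then x j else x k)
     else if k = n then - x n else x k)"
proof -
  have A: "ip n x (simple_root n j) = (if j < n then x j - x (j + 1) else 2 * x n)" for x
    using aff_root_eq[of n j x] assms by (simp add: aff_root_def ip_def mult.commute)
  show ?thesis
    unfolding reflection_def A using assms by (auto simp: simple_root_def unit_vec_def field_simps)
qed

lemma sref_0:
  assumes "n \<ge> 1"
  shows "sref n 0 x k = (if k = 1 then 1 - x 1 else x k)"
proof -
  have A: "ip n x highest_root = 2 * x 1" for x
    using aff_root_eq[of n 0 x] assms by (simp add: aff_root_def ip_def mult.commute)
  show ?thesis
    by (simp add: sref_def transl_def coroot_def reflection_def A)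
      (simp add: highest_root_def unit_vec_def)
qed

lemma sref_int:
  assumes "n \<ge> 1" "j \<le> n" "\<And>k. x k \<in> \<int>"
  shows "sref n j x k \<in> \<int>"
proof (cases "j = 0")
  case True
  then show ?thesis using assms by (auto simp: sref_0)
next
  case False
  then show ?thesis using assms by (simp add: sref_def reflection_simple_root)
qed

lemma aff_weyl_int:
  assumes "n \<ge> 1" "w \<in> aff_weyl n" "\<And>k. x k \<in> \<int>"
  shows "w x k \<in> \<int>"
proof -
  have "word_prod n is x k \<in> \<int>" if "set is \<subseteq> {0..n}" for "is" k
    using that
  proof (induction "is" arbitrary: k)
    case Nil
    then show ?case by (simp add: word_prod_def assms(3))
  next
    case (Cons i "is")
    then show ?case using assms(1) by (simp add: word_prod_def sref_int)
  qed
  with assms(2) show ?thesis by (auto simp: aff_weyl_def)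
qed

lemma diag_group_decomp_unique:
  assumes n: "n \<ge> 1" and w: "w \<in> aff_weyl n" "w' \<in> aff_weyl n"
    and l: "l \<in> diag_group n" "l' \<in> diag_group n" and eq: "l \<circ> w = l' \<circ> w'"
  shows "l = l' \<and> w = w'"
proof -
  have no: "diag_aut n \<circ> v \<noteq> v'" if "v \<in> aff_weyl n" "v' \<in> aff_weyl n" for v v'
  proof
    assume "diag_aut n \<circ> v = v'"
    then have "diag_aut n (v (\<lambda>_. 0)) 1 = v' (\<lambda>_. 0) 1" by (auto simp: fun_eq_iff)
    then have "1 / 2 = v (\<lambda>_. 0) n + v' (\<lambda>_. 0) 1" using n by (simp add: diag_aut_def)
    also have "\<dots> \<in> \<int>"
      using aff_weyl_int[OF n that(1), of "\<lambda>_. 0" n] aff_weyl_int[OF n that(2), of "\<lambda>_. 0" 1]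
      by (intro Ints_add) simp_all
    finally have "(1 / 2 :: real) \<in> \<int>" .
    then obtain m :: int where "1 / 2 = (of_int m :: real)" by (elim Ints_cases)
    then have "of_int (2 * m) = (1 :: real)" by simp
    then have "2 * m = 1" by linarith
    then show False by presburger
  qed
  have inj: "v = v'" if "diag_aut n \<circ> v = diag_aut n \<circ> v'" for v v'
  proof
    fix x
    have "diag_aut n (v x) = diag_aut n (v' x)" using fun_cong[OF that, of x] by simp
    then have "diag_aut n (diag_aut n (v x)) = diag_aut n (diag_aut n (v' x))" by (rule arg_cong)
    then show "v x = v' x" by (simp only: diag_aut_involution)
  qed
  from l consider "l = id" "l' = id" | "l = diag_aut n" "l' = diag_aut n"
    | "l = id" "l' = diag_aut n" | "l = diag_aut n" "l' = id"
    by (auto simp: diag_group_def)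
  then show ?thesis
  proof cases
    case 1 then show ?thesis using eq by simp
  next
    case 2 then show ?thesis using eq inj by simp
  next
    case 3 then show ?thesis using eq no[OF w(2,1)] by simp
  next
    case 4 then show ?thesis using eq no[OF w] by simp
  qed
qed

lemma ext_length_diag_aff:
  assumes "n \<ge> 1" "l \<in> diag_group n" "w \<in> aff_weyl n"
  shows "ext_length n (l \<circ> w) = cox_length n w"
proof -
  have "(THE v. v \<in> aff_weyl n \<and> (\<exists>l'\<in>diag_group n. l \<circ> w = l' \<circ> v)) = w"
  proof (rule the_equality)
    show "w \<in> aff_weyl n \<and> (\<exists>l'\<in>diag_group n. l \<circ> w = l' \<circ> w)"
      using assms(2,3) by (intro conjI bexI[of _ l] refl)
  next
    fix v assume "v \<in> aff_weyl n \<and> (\<exists>l'\<in>diag_group n. l \<circ> w = l' \<circ> v)"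
    then obtain l' where "v \<in> aff_weyl n" "l' \<in> diag_group n" "l \<circ> w = l' \<circ> v"
      by (elim conjE bexE)
    from diag_group_decomp_unique[OF assms(1,3) this(1) assms(2) this(2,3)]
    show "v = w" by simp
  qed
  then show ?thesis by (simp add: ext_length_def)
qed

end

theory Submission imports Defs begin

text \<open>
  The equalities are computations with signed, translated permutations of the coordinates.
  For reducedness, count the affine root hyperplanes that separate a generic point from the
  fundamental alcove.  A simple reflection permutes these hyperplanes, and only one of them
  separates the alcove from its mirror image, so this count grows by at most one per letter of a word.
  Evaluated at the image of a point of the alcove, it equals the length of the given word.
\<close>

section \<open>Products of simple reflections\<close>

lemma word_prod_Nil [simp]: "word_prod n [] = id"
  by (simp add: word_prod_def)

lemma word_prod_Cons [simp]: "word_prod n (i # is) = sref n i \<circ> word_prod n is"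
  by (simp add: word_prod_def)

lemma word_prod_append [simp]: "word_prod n (is @ js) = word_prod n is \<circ> word_prod n js"
  by (induction "is") (simp_all add: comp_assoc)

lemma sref_less:
  assumes "1 \<le> j" "j < n"
  shows "sref n j x k = (if k = j then x (j + 1) else if k = j + 1 then x j else x k)"
  using assms by (simp add: sref_def reflection_simple_root)

lemma sref_last:
  assumes "1 \<le> n"
  shows "sref n n x k = (if k = n then - x n else x k)"
  using assms by (simp add: sref_def reflection_simple_root)

text \<open>Each letter is an adjacent transposition, so the product is a cycle of coordinates. The
  half-open interval gives the induction an empty word to start from, and both kinds of segment
  below reduce to it.\<close>

lemma word_prod_upt:
  assumes "1 \<le> k" "k \<le> l" "l \<le> n"
  shows "word_prod n [k..<l] x j =
    (if j = k then x l else if k < j \<and> j \<le> l then x (j - 1) else x j)"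
  using assms(2,3)
proof (induction l arbitrary: x j rule: dec_induct)
  case base
  then show ?case by simp
next
  case (step l)
  have "word_prod n [k..<Suc l] x j = word_prod n [k..<l] (sref n l x) j"
    using step by simp
  then show ?case
    using step assms(1) by (auto simp: sref_less)
qed

lemma word_prod_seg_less:
  assumes "1 \<le> k" "k \<le> l" "l < n"
  shows "word_prod n (seg k l) x j =
    (if j = k then x (Suc l) else if k < j \<and> j \<le> Suc l then x (j - 1) else x j)"
  using assms unfolding seg_def by (subst word_prod_upt) auto

lemma word_prod_seg_last:
  assumes "1 \<le> k" "k \<le> n"
  shows "word_prod n (seg k n) x j =
    (if j = k then - x n else if k < j \<and> j \<le> n then x (j - 1) else x j)"
proof -
  have "word_prod n (seg k n) x j = word_prod n [k..<n] (sref n n x) j"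
    using assms by (simp add: seg_def)
  then show ?thesis
    using assms by (auto simp: word_prod_upt sref_last)
qed

text \<open>A new row acts on the left of those already present: it carries the last coordinate,
  negated, to position \<open>Suc m\<close> and moves the coordinates in between one place
  back.\<close>

lemma word_prod_stair_partial:
  assumes "m \<le> n"
  shows "word_prod n (concat (map (\<lambda>j. seg j n) (rev [1..<Suc m]))) x k =
    (if k \<in> {1..m} then - x (n + 1 - k) else if k \<in> {m<..n} then x (k - m) else x k)"
  using assms
proof (induction m arbitrary: k)
  case 0
  then show ?case by simp
next
  case (Suc m)
  let ?r = "word_prod n (concat (map (\<lambda>j. seg j n) (rev [1..<Suc m]))) x"
  have IH: "?r k = (if k \<in> {1..m} then - x (n + 1 - k) else if k \<in> {m<..n} then x (k - m) else x k)"
    for k using Suc.IH Suc.prems by simp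
  have "word_prod n (concat (map (\<lambda>j. seg j n) (rev [1..<Suc (Suc m)]))) x k =
      word_prod n (seg (Suc m) n) ?r k" by simp
  also have "\<dots> = (if k = Suc m then - ?r n else if Suc m < k \<and> k \<le> n then ?r (k - 1) else ?r k)"
    using Suc.prems by (intro word_prod_seg_last) auto
  finally show ?case unfolding IH using Suc.prems by (simp del: upt_Suc) auto
qed

lemma word_prod_stair_word:
  "word_prod n (stair_word n) x k = (if k \<in> {1..n} then - x (n + 1 - k) else x k)"
  unfolding stair_word_def by (subst word_prod_stair_partial) auto

text \<open>In one factor the segment brings \<open>- x n\<close> to the front, and
  \<open>sref n 0\<close> turns it into \<open>1 + x n\<close>. The two signs cancel, so each factor
  is a rotation followed by translation by e_1.\<close>

lemma word_prod_power_word: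
  assumes "1 \<le> n" "i \<le> n"
  shows "word_prod n (power_word n i) x k =
    (if k \<in> {1..i} then 1 + x (n - i + k) else if k \<in> {i<..n} then x (k - i) else x k)"
  using assms(2)
proof (induction i arbitrary: k)
  case 0
  then show ?case by (simp add: power_word_def)
next
  case (Suc i)
  have "word_prod n (power_word n (Suc i)) x k =
      sref n 0 (word_prod n (seg 1 n) (word_prod n (power_word n i) x)) k"
    by (simp add: power_word_def)
  \<comment> \<open>\<open>n - i\<close> is where the earlier factors left the coordinate that is
    about to wrap around; \<open>Suc i \<le> n\<close> keeps the subtraction from
    truncating.\<close>
  moreover have "Suc (n - Suc i) = n - i" using Suc.prems by simp
  ultimately show ?case
    using Suc assms(1)
    by (cases "k \<le> 1") (auto simp: sref_0 word_prod_seg_last not_le diff_diff_left)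
qed

text \<open>Factor j carries coordinate j + i past the i coordinates being moved back. Its last
  letter j + i - 1 stays below \<open>n\<close>, so no sign appears.\<close>

lemma word_prod_block_partial:
  assumes "1 \<le> i" "m + i \<le> n"
  shows "word_prod n (concat (map (\<lambda>j. seg j (j + i - 1)) (rev [1..<Suc m]))) x k =
    (if k \<in> {1..m} then x (k + i) else if k \<in> {m<..m + i} then x (k - m) else x k)"
  using assms(2)
proof (induction m arbitrary: k)
  case 0
  then show ?case by simp
next
  case (Suc m)
  let ?r = "word_prod n (concat (map (\<lambda>j. seg j (j + i - 1)) (rev [1..<Suc m]))) x"
  have IH: "?r k =
      (if k \<in> {1..m} then x (k + i) else if k \<in> {m<..m + i} then x (k - m) else x k)" for k
    using Suc.IH Suc.prems by simp
  have "word_prod n (concat (map (\<lambda>j. seg j (j + i - 1)) (rev [1..<Suc (Suc m)]))) x k =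
      word_prod n (seg (Suc m) (m + i)) ?r k" by simp
  also have "\<dots> = (if k = Suc m then ?r (Suc (m + i))
      else if Suc m < k \<and> k \<le> Suc (m + i) then ?r (k - 1) else ?r k)"
    using Suc.prems assms(1) by (intro word_prod_seg_less) auto
  finally show ?case unfolding IH using Suc.prems assms(1) by (simp del: upt_Suc) auto
qed

lemma word_prod_block_word:
  assumes "1 \<le> i" "i \<le> n"
  shows "word_prod n (block_word n i) x k =
    (if k \<in> {1..n - i} then x (k + i) else if k \<in> {n - i<..n} then x (k - (n - i)) else x k)"
  using assms unfolding block_word_def by (subst word_prod_block_partial) auto

text \<open>The staircase reverses and negates; \<open>diag_aut\<close> reverses again and subtracts
  from 1/2. Together they add 1/2 to every coordinate from 1 to \<open>n\<close>.\<close>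

lemma omega_last_eq:
  "omega n n = diag_aut n \<circ> word_prod n (stair_word n)"
  by (auto simp: fun_eq_iff omega_def transl_def fund_coweight_eq diag_aut_def word_prod_stair_word)

text \<open>The block word is the inverse of the rotation contained in the power word, so only the
  unit shifts of the first \<open>i\<close> coordinates survive.\<close>

lemma omega_less_eq:
  assumes "1 \<le> i" "i < n"
  shows "omega n i = word_prod n (power_word n i @ block_word n i)"
proof (intro ext)
  fix x k
  have "omega n i x k = x k + (if k \<in> {1..i} then 1 else 0)"
    using assms by (simp add: omega_def transl_def fund_coweight_eq)
  moreover have "word_prod n (power_word n i @ block_word n i) x k =
      x k + (if k \<in> {1..i} then 1 else 0)"
  proof -
    let ?y = "word_prod n (block_word n i) x"
    consider "k \<in> {1..i}" | "k \<in> {i<..n}" | "k \<notin> {1..n}" using assms by force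
    then show ?thesis
    proof cases
      case 1
      then have "n - i + k \<in> {n - i<..n}" using assms by auto
      then have "?y (n - i + k) = x k" using assms by (simp add: word_prod_block_word)
      with 1 show ?thesis using assms by (simp add: word_prod_power_word)
    next
      case 2
      then have "k - i \<in> {1..n - i}" by auto
      then have "?y (k - i) = x k" using assms 2 by (simp add: word_prod_block_word)
      with 2 show ?thesis using assms by (simp add: word_prod_power_word)
    next
      case 3
      then have "k \<notin> {1..i}" "k \<notin> {i<..n}" "k \<notin> {1..n - i}" "k \<notin> {n - i<..n}"
        using assms by auto
      then show ?thesis
        using assms by (simp only: word_prod_append comp_apply word_prod_power_word
            word_prod_block_word less_imp_le order.trans if_False add_0_right)
    qed
  qed
  ultimately show "omega n i x k = word_prod n (power_word n i @ block_word n i) x k" by simp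
qed

section \<open>Separating hyperplanes\<close>

text \<open>This says that \<open>y\<close> lies on no affine root hyperplane; the sums with
  \<open>a = b\<close> account for the long roots.\<close>

definition regular :: "nat \<Rightarrow> rvec \<Rightarrow> bool" where
  "regular n y \<longleftrightarrow> (\<forall>a\<in>{1..n}. \<forall>b\<in>{1..n}. y a + y b \<notin> \<int> \<and> (a \<noteq> b \<longrightarrow> y a - y b \<notin> \<int>))"

text \<open>These index the short positive roots e_a - e_b and e_a + e_b; the \<open>SIGMA\<close>
  form lets sums be split according to a.\<close>

definition pos_pairs :: "nat \<Rightarrow> (nat \<times> nat) set" where
  "pos_pairs n = (SIGMA a:{1..n}. {a<..n})"

text \<open>The positive roots take values in \<open>(0, 1)\<close> on the fundamental alcove, so for a
  root with non-integral value \<open>v\<close> at \<open>y\<close> exactly \<open>\<bar>\<lfloor>v\<rfloor>\<bar>\<close> of its hyperplanes separate \<open>y\<close>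
  from the alcove.\<close>

definition separation :: "nat \<Rightarrow> rvec \<Rightarrow> int" where
  "separation n y = (\<Sum>a=1..n. \<bar>\<lfloor>2 * y a\<rfloor>\<bar>) +
     (\<Sum>(a, b)\<in>pos_pairs n. \<bar>\<lfloor>y a - y b\<rfloor>\<bar> + \<bar>\<lfloor>y a + y b\<rfloor>\<bar>)"

lemma finite_pos_pairs [simp]: "finite (pos_pairs n)"
  by (simp add: pos_pairs_def)

lemma mem_pos_pairs [simp]: "(a, b) \<in> pos_pairs n \<longleftrightarrow> 1 \<le> a \<and> a < b \<and> b \<le> n"
  by (auto simp: pos_pairs_def)

section \<open>Effect of one simple reflection on the separation count\<close>

lemma abs_floor_uminus_le: "\<bar>\<lfloor>- v\<rfloor>\<bar> \<le> \<bar>\<lfloor>v :: real\<rfloor>\<bar> + 1"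
  by linarith

lemma floor_diff_not_Ints:
  fixes v :: real
  assumes "v \<notin> \<int>"
  shows "\<lfloor>of_int m - v\<rfloor> = m - 1 - \<lfloor>v\<rfloor>"
proof -
  have "v \<noteq> of_int \<lfloor>v\<rfloor>" using assms by (metis Ints_of_int)
  then show ?thesis by linarith
qed

text \<open>This serves the long roots under \<open>s_0\<close> and \<open>s_n\<close>, where a
  single coordinate changes.\<close>

lemma sum_le_sum_except_one:
  fixes f g :: "'a \<Rightarrow> int"
  assumes "finite A" "c \<in> A" "f c \<le> g c + 1" "\<And>x. x \<in> A - {c} \<Longrightarrow> f x = g x"
  shows "sum f A \<le> sum g A + 1"
proof -
  have "sum f (A - {c}) = sum g (A - {c})" using assms(4) by (rule sum.cong[OF refl])
  then show ?thesis
    using assms(3) by (simp add: sum.remove[OF assms(1,2)])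
qed

text \<open>Affine reflections permute the affine roots: each sum or difference at the image is, up
  to sign and an integer shift, one at \<open>y\<close>.\<close>

lemma regular_sref:
  assumes "1 \<le> n" "j \<le> n" "regular n y"
  shows "regular n (sref n j y)"
proof -
  have r: "y a + y b \<notin> \<int>" "a \<noteq> b \<Longrightarrow> y a - y b \<notin> \<int>" if "a \<in> {1..n}" "b \<in> {1..n}" for a b
    using assms(3) that by (auto simp: regular_def)
  have neg: "- v \<notin> \<int>" if "v \<notin> \<int>" for v :: real using that by simp
  \<comment> \<open>These are the integer shifts that \<open>s_0\<close> introduces.\<close>
  have one: "1 - v \<notin> \<int>" "1 + v \<notin> \<int>" "v - 1 \<notin> \<int>" "2 - v \<notin> \<int>" if "v \<notin> \<int>" for v :: real
  proof -
    show "1 - v \<notin> \<int>" using that Ints_diff[of 1 "1 - v"] by auto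
    show "1 + v \<notin> \<int>" using that Ints_diff[of "1 + v" 1] by auto
    show "v - 1 \<notin> \<int>" using that Ints_add[of "v - 1" 1] by auto
    show "2 - v \<notin> \<int>" using that Ints_diff[of 2 "2 - v"] by auto
  qed
  consider "j = 0" | "1 \<le> j" "j < n" | "1 \<le> j" "j = n" using assms(2) by linarith
  then show ?thesis
  proof cases
    case 1
    have "2 - (y 1 + y 1) \<notin> \<int>" using one r[of 1 1] assms(1) by auto
    moreover have "1 - (y 1 + y b) \<notin> \<int>" "1 - (y 1 - y b) \<notin> \<int>" "(y 1 + y b) - 1 \<notin> \<int>"
      "(y 1 - y b) - 1 \<notin> \<int>" if "b \<in> {1..n}" "b \<noteq> 1" for b
      using one r[of 1 b] that assms(1) by auto
    ultimately show ?thesis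
      using assms(1) r unfolding regular_def 1 sref_0[OF assms(1)]
      by (auto simp: algebra_simps)
  next
    case 2
    moreover have "2 * y a \<notin> \<int>" if "a \<in> {1..n}" for a using r(1)[OF that that] by simp
    ultimately show ?thesis unfolding regular_def sref_less[OF 2] using r by auto
  next
    case 3
    have "- y n - y b \<notin> \<int>" if "b \<in> {1..n}" for b
      using neg[OF r(1)[of n b]] that assms(1) by simp
    moreover have "y b - y n \<notin> \<int>" "- y n + y b \<notin> \<int>" if "b \<in> {1..n}" "b \<noteq> n" for b
      using r(2)[of b n] that assms(1) by auto
    moreover have "2 * y a \<notin> \<int>" if "a \<in> {1..n}" for a using r(1)[OF that that] by simp
    ultimately show ?thesis
      using assms(1) r unfolding regular_def 3 sref_last[OF assms(1)] by auto
  qed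
qed

text \<open>Only the term of the reflecting root (the highest root for \<open>s_0\<close>) can grow,
  and by at most one; the contributions of the other positive roots are permuted.\<close>

lemma separation_sref_le:
  assumes "1 \<le> n" "j \<le> n" "regular n y"
  shows "separation n (sref n j y) \<le> separation n y + 1"
proof -
  have r: "y a + y b \<notin> \<int>" "a \<noteq> b \<Longrightarrow> y a - y b \<notin> \<int>" if "a \<in> {1..n}" "b \<in> {1..n}" for a b
    using assms(3) that by (auto simp: regular_def)
  let ?z = "sref n j y"
  let ?f = "\<lambda>y (a, b). \<bar>\<lfloor>y a - y b\<rfloor>\<bar> + \<bar>\<lfloor>y a + y b\<rfloor>\<bar>"
  consider "j = 0" | "1 \<le> j" "j < n" | "1 \<le> j" "j = n" using assms(2) by linarith
  then show ?thesis
  proof cases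
    case 1
    have "(\<Sum>a=1..n. \<bar>\<lfloor>2 * ?z a\<rfloor>\<bar>) \<le> (\<Sum>a=1..n. \<bar>\<lfloor>2 * y a\<rfloor>\<bar>) + 1"
    proof (rule sum_le_sum_except_one[of _ 1])
      have "2 * y 1 \<notin> \<int>" using r(1)[of 1 1] assms(1) by simp
      \<comment> \<open>The shift is 2 because 2e_1 doubles the coordinate; the resulting 1 is the
        single wall crossed.\<close>
      then have "\<lfloor>2 - 2 * y 1\<rfloor> = 1 - \<lfloor>2 * y 1\<rfloor>" using floor_diff_not_Ints[of "2 * y 1" 2] by simp
      moreover have "2 * ?z 1 = 2 - 2 * y 1" using assms(1) by (simp add: 1 sref_0)
      ultimately show "\<bar>\<lfloor>2 * ?z 1\<rfloor>\<bar> \<le> \<bar>\<lfloor>2 * y 1\<rfloor>\<bar> + 1" by linarith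
    qed (use assms(1) in \<open>auto simp: 1 sref_0\<close>)
    moreover have "sum (?f ?z) (pos_pairs n) = sum (?f y) (pos_pairs n)"
    proof (rule sum.cong[OF refl], clarify)
      fix a b assume ab: "(a, b) \<in> pos_pairs n"
      show "\<bar>\<lfloor>?z a - ?z b\<rfloor>\<bar> + \<bar>\<lfloor>?z a + ?z b\<rfloor>\<bar> = \<bar>\<lfloor>y a - y b\<rfloor>\<bar> + \<bar>\<lfloor>y a + y b\<rfloor>\<bar>"
      proof (cases "a = 1")
        case True
        \<comment> \<open>\<open>s_0\<close> interchanges e_1 - e_b and e_1 + e_b up to sign and a
          shift by 1. At non-integral values this shift makes the floor merely change sign.\<close>
        have "?z a - ?z b = 1 - (y 1 + y b)" "?z a + ?z b = 1 - (y 1 - y b)"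
          using ab True assms(1) by (auto simp: 1 sref_0)
        moreover have "\<lfloor>1 - (y 1 + y b)\<rfloor> = - \<lfloor>y 1 + y b\<rfloor>" "\<lfloor>1 - (y 1 - y b)\<rfloor> = - \<lfloor>y 1 - y b\<rfloor>"
          using floor_diff_not_Ints[of "y 1 + y b" 1] floor_diff_not_Ints[of "y 1 - y b" 1]
            r[of 1 b] ab True assms(1) by simp_all
        ultimately show ?thesis using True by simp
      next
        case False
        then show ?thesis using ab assms(1) by (simp add: 1 sref_0)
      qed
    qed
    ultimately show ?thesis unfolding separation_def by linarith
  next
    case 2
    let ?s = "\<lambda>k. if k = j then j + 1 else if k = j + 1 then j else k"
    have z: "?z k = y (?s k)" for k using 2 by (simp add: sref_less)
    have "(\<Sum>a=1..n. \<bar>\<lfloor>2 * ?z a\<rfloor>\<bar>) = (\<Sum>a=1..n. \<bar>\<lfloor>2 * y a\<rfloor>\<bar>)"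
      unfolding z by (rule sum.reindex_bij_witness[of _ ?s ?s]) (use 2 in \<open>auto split: if_splits\<close>)
    moreover have "sum (?f ?z) (pos_pairs n) \<le> sum (?f y) (pos_pairs n) + 1"
    proof -
      have c: "(j, j + 1) \<in> pos_pairs n" using 2 by simp
      \<comment> \<open>Swapping j and j + 1 in both components preserves a < b for every pair but
        the one removed; there the sum is unchanged and the difference changes sign.\<close>
      have "sum (?f ?z) (pos_pairs n - {(j, j + 1)}) = sum (?f y) (pos_pairs n - {(j, j + 1)})"
        by (rule sum.reindex_bij_witness[of _ "map_prod ?s ?s" "map_prod ?s ?s"])
          (use 2 in \<open>auto simp: z split: if_splits\<close>)
      moreover have "?f ?z (j, j + 1) \<le> ?f y (j, j + 1) + 1"
        using abs_floor_uminus_le[of "y j - y (j + 1)"] by (simp add: z add.commute)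
      ultimately show ?thesis
        by (simp only: sum.remove[OF finite_pos_pairs c])
    qed
    ultimately show ?thesis unfolding separation_def by linarith
  next
    case 3
    have "(\<Sum>a=1..n. \<bar>\<lfloor>2 * ?z a\<rfloor>\<bar>) \<le> (\<Sum>a=1..n. \<bar>\<lfloor>2 * y a\<rfloor>\<bar>) + 1"
    proof (rule sum_le_sum_except_one[of _ n])
      show "\<bar>\<lfloor>2 * ?z n\<rfloor>\<bar> \<le> \<bar>\<lfloor>2 * y n\<rfloor>\<bar> + 1"
        using abs_floor_uminus_le[of "2 * y n"] assms(1) by (simp add: 3 sref_last)
    qed (use assms(1) in \<open>auto simp: 3 sref_last\<close>)
    \<comment> \<open>Negating coordinate \<open>n\<close> interchanges e_a - e_n and e_a + e_n,
      which share one summand.\<close>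
    moreover have "sum (?f ?z) (pos_pairs n) = sum (?f y) (pos_pairs n)"
      by (rule sum.cong) (use assms(1) in \<open>auto simp: 3 sref_last\<close>)
    ultimately show ?thesis unfolding separation_def by linarith
  qed
qed

lemma separation_word_prod_le:
  assumes "1 \<le> n" "set is \<subseteq> {0..n}" "regular n y"
  shows "separation n (word_prod n is y) \<le> separation n y + int (length is)"
proof -
  \<comment> \<open>Regularity is carried through the induction because the one-letter bound assumes
    it.\<close>
  have "regular n (word_prod n is y) \<and>
      separation n (word_prod n is y) \<le> separation n y + int (length is)"
    using assms(2)
  proof (induction "is")
    case Nil
    then show ?case using assms(3) by simp
  next
    case (Cons i "is")
    then have "i \<le> n" and r: "regular n (word_prod n is y)"
      and le: "separation n (word_prod n is y) \<le> separation n y + int (length is)" by auto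
    with regular_sref[OF assms(1) \<open>i \<le> n\<close> r] separation_sref_le[OF assms(1) \<open>i \<le> n\<close> r]
    show ?case by simp
  qed
  then show ?thesis ..
qed

section \<open>A point inside the fundamental alcove and the separation of its images\<close>

definition base_point :: rvec where
  "base_point k = 1 / (real k + 2)"

lemma base_point_diff:
  assumes "a < b"
  shows "0 < base_point a - base_point b" "base_point a - base_point b < 1"
proof -
  show "0 < base_point a - base_point b" using assms by (simp add: base_point_def frac_less2)
  have "base_point a \<le> 1 / 2" "0 < base_point b" by (simp_all add: base_point_def field_simps)
  then show "base_point a - base_point b < 1" by linarith
qed

text \<open>The offset 2 in \<open>base_point\<close> puts all coordinates from index 1 on strictly
  below 1/2, that is, on the inner side of the wall of \<open>s_0\<close>.\<close>

lemma base_point_add: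
  assumes "1 \<le> a" "1 \<le> b"
  shows "0 < base_point a + base_point b" "base_point a + base_point b < 1"
proof -
  have "0 < base_point k \<and> base_point k < 1 / 2" if "1 \<le> k" for k
    using that by (simp add: base_point_def field_simps)
  from this[OF assms(1)] this[OF assms(2)]
  show "0 < base_point a + base_point b" "base_point a + base_point b < 1" by linarith+
qed

lemma not_Ints_unit_interval:
  fixes v :: real
  assumes "0 < v" "v < 1"
  shows "v \<notin> \<int>"
  using assms by (auto elim!: Ints_cases)

lemma regular_base_point: "regular n base_point"
proof -
  have "base_point a - base_point b \<notin> \<int>" if "a \<noteq> b" for a b
  proof (cases "a < b")
    case True
    then show ?thesis using base_point_diff not_Ints_unit_interval by blast
  next
    case False
    then have "base_point b - base_point a \<notin> \<int>"
      using that base_point_diff[of b a] not_Ints_unit_interval by force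
    then show ?thesis using Ints_minus by fastforce
  qed
  then show ?thesis
    using base_point_add not_Ints_unit_interval by (auto simp: regular_def)
qed

lemma floor_base_point:
  "a < b \<Longrightarrow> \<lfloor>base_point a - base_point b\<rfloor> = 0"
  "1 \<le> a \<Longrightarrow> 1 \<le> b \<Longrightarrow> \<lfloor>base_point a + base_point b\<rfloor> = 0"
  "1 \<le> a \<Longrightarrow> 1 \<le> b \<Longrightarrow> \<lfloor>- base_point a - base_point b\<rfloor> = - 1"
  using base_point_diff[of a b] base_point_add[of a b] by (auto simp: floor_eq_iff)

lemma floor_double_base_point:
  assumes "1 \<le> a"
  shows "\<lfloor>2 * base_point a\<rfloor> = 0" "\<lfloor>- (2 * base_point a)\<rfloor> = - 1"
  using base_point_add[OF assms assms] by (simp_all add: floor_eq_iff)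

lemma separation_base_point: "separation n base_point = 0"
  by (auto simp: separation_def floor_base_point floor_double_base_point intro!: sum.neutral)

text \<open>Negation sends each sum, including 2e_a, into (-1, 0), across one hyperplane; reversal
  and negation together keep the differences in (0, 1). Collecting by the smaller index a gives 1 +
  (n - a), the length of row a.\<close>

lemma separation_stair_word:
  "separation n (word_prod n (stair_word n) base_point) = (\<Sum>a=1..n. int (Suc n - a))"
proof -
  let ?y = "word_prod n (stair_word n) base_point"
  have y: "?y a = - base_point (n + 1 - a)" if "1 \<le> a" "a \<le> n" for a
    using that by (simp add: word_prod_stair_word)
  have "(\<Sum>a=1..n. \<bar>\<lfloor>2 * ?y a\<rfloor>\<bar>) = (\<Sum>a=1..n. 1)"
    by (rule sum.cong) (auto simp: y floor_double_base_point)
  moreover have "(\<Sum>(a, b)\<in>pos_pairs n. \<bar>\<lfloor>?y a - ?y b\<rfloor>\<bar> + \<bar>\<lfloor>?y a + ?y b\<rfloor>\<bar>) =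
      (\<Sum>(a, b)\<in>pos_pairs n. 1)"
  proof (rule sum.cong[OF refl], clarify)
    fix a b assume "(a, b) \<in> pos_pairs n"
    then have "1 \<le> a" "a < b" "b \<le> n" by auto
    moreover from this have "n + 1 - b < n + 1 - a" "1 \<le> n + 1 - a" "1 \<le> n + 1 - b" by linarith+
    ultimately show "\<bar>\<lfloor>?y a - ?y b\<rfloor>\<bar> + \<bar>\<lfloor>?y a + ?y b\<rfloor>\<bar> = 1"
      using floor_base_point(1)[of "n + 1 - b" "n + 1 - a"]
        floor_base_point(3)[of "n + 1 - a" "n + 1 - b"]
      by (simp add: y)
  qed
  moreover have "(\<Sum>(a, b)\<in>pos_pairs n. (1 :: int)) = (\<Sum>a=1..n. int (n - a))"
    unfolding pos_pairs_def by (subst sum.Sigma[symmetric]) auto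
  ultimately have "separation n ?y = (\<Sum>a=1..n. 1 + int (n - a))"
    by (simp add: separation_def sum.distrib)
  also have "\<dots> = (\<Sum>a=1..n. int (Suc n - a))"
    by (rule sum.cong) auto
  finally show ?thesis .
qed

text \<open>The translation raises 2e_a by 2 for a \<le> i. A pair a < b contributes 0 + 2 if both
  coordinates move and 1 + 1 if only a moves, so its share depends on a alone.\<close>

lemma separation_omega_less:
  assumes "i < n"
  shows "separation n (omega n i base_point) = (\<Sum>a=1..i. 2 * int (Suc n - a))"
proof -
  let ?y = "omega n i base_point"
  have y: "?y a = base_point a + (if a \<le> i then 1 else 0)" if "1 \<le> a" for a
    using that assms by (simp add: omega_def transl_def fund_coweight_eq)
  have "(\<Sum>a=1..n. \<bar>\<lfloor>2 * ?y a\<rfloor>\<bar>) = (\<Sum>a=1..n. if a \<le> i then 2 else 0)"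
    by (rule sum.cong) (auto simp: y floor_double_base_point distrib_left)
  moreover have "(\<Sum>(a, b)\<in>pos_pairs n. \<bar>\<lfloor>?y a - ?y b\<rfloor>\<bar> + \<bar>\<lfloor>?y a + ?y b\<rfloor>\<bar>) =
      (\<Sum>(a, b)\<in>pos_pairs n. if a \<le> i then 2 else 0)"
  proof (rule sum.cong[OF refl], clarify)
    fix a b assume ab: "(a, b) \<in> pos_pairs n"
    have d: "0 < base_point a - base_point b" "base_point a - base_point b < 1"
      using ab base_point_diff by auto
    have s: "0 < base_point a + base_point b" "base_point a + base_point b < 1"
      using ab base_point_add[of a b] by auto
    have ya: "?y a = base_point a + (if a \<le> i then 1 else 0)"
      and yb: "?y b = base_point b + (if b \<le> i then 1 else 0)" using ab y by auto
    \<comment> \<open>The fourth combination is excluded by a < b.\<close>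
    consider "b \<le> i" "a \<le> i" | "\<not> b \<le> i" "a \<le> i" | "\<not> b \<le> i" "\<not> a \<le> i"
      using ab by fastforce
    then show "\<bar>\<lfloor>?y a - ?y b\<rfloor>\<bar> + \<bar>\<lfloor>?y a + ?y b\<rfloor>\<bar> = (if a \<le> i then 2 else 0)"
    proof cases
      case 1
      then have "\<lfloor>?y a - ?y b\<rfloor> = 0" "\<lfloor>?y a + ?y b\<rfloor> = 2"
        using d s ya yb by (auto simp: floor_eq_iff)
      with 1 show ?thesis by simp
    next
      case 2
      then have "\<lfloor>?y a - ?y b\<rfloor> = 1" "\<lfloor>?y a + ?y b\<rfloor> = 1"
        using d s ya yb by (auto simp: floor_eq_iff)
      with 2 show ?thesis by simp
    next
      case 3
      then have "\<lfloor>?y a - ?y b\<rfloor> = 0" "\<lfloor>?y a + ?y b\<rfloor> = 0"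
        using d s ya yb by (auto simp: floor_eq_iff)
      with 3 show ?thesis by simp
    qed
  qed
  moreover have "(\<Sum>(a, b)\<in>pos_pairs n. if a \<le> i then 2 else (0 :: int)) =
      (\<Sum>a=1..n. if a \<le> i then 2 * int (n - a) else 0)"
    unfolding pos_pairs_def by (subst sum.Sigma[symmetric]) (auto intro!: sum.cong)
  ultimately have "separation n ?y =
      (\<Sum>a=1..n. (if a \<le> i then 2 else 0) + (if a \<le> i then 2 * int (n - a) else 0))"
    by (simp add: separation_def sum.distrib)
  also have "\<dots> = (\<Sum>a=1..i. 2 * int (Suc n - a))"
    by (rule sum.mono_neutral_cong_right) (use assms in auto)
  finally show ?thesis .
qed

section \<open>Reduced expressions\<close>

text \<open>Any word for the same element moves the base point to the same place, and its length
  bounds the separation there, since the count starts from zero.\<close>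

lemma cox_length_eqI:
  assumes "1 \<le> n" "set is \<subseteq> {0..n}"
    and "separation n (word_prod n is base_point) = int (length is)"
  shows "cox_length n (word_prod n is) = length is"
  unfolding cox_length_def
proof (rule Least_equality)
  show "\<exists>js. set js \<subseteq> {0..n} \<and> length js = length is \<and> word_prod n js = word_prod n is"
    using assms(2) by blast
next
  fix r assume "\<exists>js. set js \<subseteq> {0..n} \<and> length js = r \<and> word_prod n js = word_prod n is"
  then obtain js where "set js \<subseteq> {0..n}" "length js = r" "word_prod n js = word_prod n is" by blast
  with separation_word_prod_le[OF assms(1) this(1) regular_base_point[of n]] assms(3)
  show "length is \<le> r" by (simp add: separation_base_point)
qed

lemma omega_in_ext_weyl:
  assumes "i \<in> {1..n}"
  shows "omega n i \<in> ext_weyl n"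
proof -
  have "(\<lambda>k. \<Sum>j=1..n. of_int (if j = i then 1 else 0) * fund_coweight n j k) = fund_coweight n i"
  proof
    fix k
    have "(\<Sum>j=1..n. of_int (if j = i then 1 else 0) * fund_coweight n j k) =
        (\<Sum>j=1..n. if j = i then fund_coweight n j k else 0)"
      by (rule sum.cong) auto
    then show "(\<Sum>j=1..n. of_int (if j = i then 1 else 0) * fund_coweight n j k) =
        fund_coweight n i k" using assms by simp
  qed
  then have "omega n i =
      transl (\<lambda>k. \<Sum>j=1..n. of_int (if j = i then 1 else 0) * fund_coweight n j k)"
    by (simp only: omega_def)
  then have "omega n i \<in> transl_lattice n"
    unfolding transl_lattice_def
    by (intro CollectI exI[of _ "\<lambda>j. if j = i then 1 else 0"] conjI TrueI)
  moreover have "id \<in> fin_weyl n"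
    unfolding fin_weyl_def by (rule CollectI, rule exI[of _ "[]"]) simp
  ultimately show ?thesis
    unfolding ext_weyl_def by (intro CollectI exI[of _ "omega n i"] exI[of _ id]) simp
qed

text \<open>The diagram factor has length zero, so the count is made for the word part
  alone.\<close>

lemma reduced_expr_omegaI:
  assumes "i \<in> {1..n}" "l \<in> diag_group n" "set is \<subseteq> {0..n}"
    and "omega n i = l \<circ> word_prod n is"
    and "separation n (word_prod n is base_point) = int (length is)"
  shows "reduced_expr n l is"
proof -
  have n: "1 \<le> n" using assms(1) by simp
  have "word_prod n is \<in> aff_weyl n" using assms(3) by (auto simp: aff_weyl_def)
  then show ?thesis
    using assms omega_in_ext_weyl[OF assms(1)] ext_length_diag_aff[OF n assms(2)]
      cox_length_eqI[OF n assms(3,5)]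
    by (simp add: reduced_expr_def)
qed

section \<open>Lengths of the words and the conclusion\<close>

lemma length_stair_word: "length (stair_word n) = (\<Sum>a=1..n. Suc n - a)"
  by (simp add: stair_word_def seg_def length_concat comp_def rev_map[symmetric]
      interv_sum_list_conv_sum_set_nat atLeastLessThanSuc_atLeastAtMost del: upt_Suc)

lemma length_power_word_block_word:
  assumes "1 \<le> i" "i < n"
  shows "length (power_word n i @ block_word n i) = (\<Sum>a=1..i. 2 * (Suc n - a))"
proof -
  have "length (power_word n i) = i * Suc n"
    by (simp add: power_word_def seg_def length_concat sum_list_replicate)
  moreover have "length (block_word n i) = (n - i) * i"
    using assms(1) by (simp add: block_word_def seg_def length_concat comp_def
        rev_map[symmetric] sum_list_triv del: upt_Suc)
  \<comment> \<open>The local \<open>i\<close> shadows the fixed one, so that the induction runs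
    over all values up to \<open>n\<close>.\<close>
  moreover have "(\<Sum>a=1..i. 2 * (Suc n - a)) = i * Suc n + (n - i) * i" if "i \<le> n" for i
    using that
  proof (induction i)
    case (Suc i)
    \<comment> \<open>Writing \<open>n\<close> as \<open>Suc i + d\<close> removes the truncated
      subtractions.\<close>
    then obtain d where "n = Suc i + d" using le_Suc_ex by blast
    then show ?case using Suc by (simp add: algebra_simps)
  qed simp
  ultimately show ?thesis using assms(2) by simp
qed

theorem proposition3p6:
  fixes n :: nat
  assumes "n \<ge> 2"
  shows "(omega n n = diag_aut n \<circ> word_prod n (stair_word n) \<and>
          reduced_expr n (diag_aut n) (stair_word n)) \<and>
         (\<forall>i. 1 \<le> i \<and> i < n \<longrightarrow>
            omega n i = word_prod n (power_word n i @ block_word n i) \<and>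
            reduced_expr n id (power_word n i @ block_word n i))"
proof (intro conjI allI impI)
  show "omega n n = diag_aut n \<circ> word_prod n (stair_word n)"
    by (rule omega_last_eq)
  show "reduced_expr n (diag_aut n) (stair_word n)"
  proof (rule reduced_expr_omegaI[of n])
    show "set (stair_word n) \<subseteq> {0..n}" by (auto simp: stair_word_def seg_def)
    show "separation n (word_prod n (stair_word n) base_point) = int (length (stair_word n))"
      by (simp only: separation_stair_word length_stair_word of_nat_sum)
  qed (use assms omega_last_eq in \<open>auto simp: diag_group_def\<close>)
next
  fix i assume i: "1 \<le> i \<and> i < n"
  let ?w = "power_word n i @ block_word n i"
  show eq: "omega n i = word_prod n ?w"
    using i by (intro omega_less_eq) auto
  show "reduced_expr n id ?w"
  proof (rule reduced_expr_omegaI[of i])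
    show "set ?w \<subseteq> {0..n}"
      using i by (auto simp: power_word_def block_word_def seg_def)
    have "separation n (word_prod n ?w base_point) = (\<Sum>a=1..i. 2 * int (Suc n - a))"
      \<comment> \<open>The product formula replaces the word by the translation, whose effect on
        the base point is explicit.\<close>
      unfolding eq[symmetric] using i by (intro separation_omega_less) auto
    also have "\<dots> = int (length ?w)"
      using i length_power_word_block_word[of i n] by simp
    finally show "separation n (word_prod n ?w base_point) = int (length ?w)" .
  qed (use i eq in \<open>auto simp: diag_group_def\<close>)
qed

end
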